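(* Let $G=(V,E)$ be a connected graph such that $(V,\mathcal{M}_{m^3_3}(G))$ is a convex geometry, where $\mathcal{M}_{m^3_3}(G)$ is the collection of all $m^3_3$-convex subsets of $V$. Then $G$ is $A$-free, i.e. $G$ contains no induced subgraph isomorphic to the $A$-graph.
   Context: All graphs are finite and simple. A path in $G$ is induced if it is an induced subgraph of $G$; its length is its number of edges. For vertices $u,v$, the monophonic interval $I_m[u,v]$ is the set of all vertices lying on some induced $u$–$v$ path. The $m^3$-interval $I_{m^3}[u,v]$ is the set of all vertices lying on some induced $u$–$v$ path of length at least $3$. A set $S\subseteq V$ is $m^3$-convex if $I_{m^3}[u,v]\subseteq S$ for all $u,v\in S$. For $U\subseteq V$ with $|U|\ge 2$, a minimal $U$-tree is a subgraph $T$ of $G$ containing $U$ such that $T$ is a tree and every vertex of $V(T)\setminus U$ is a cut-vertex of the subgraph of $G$ induced by $V(T)$; the monophonic interval $I_m(U)$ is the set of all vertices lying in some minimal $U$-tree. A set $S$ is $m_3$-convex if $I_m(U)\subseteq S$ for every $3$-element subset $U\subseteq S$. A set is $m^3_3$-convex if it is both $m^3$-convex and $m_3$-convex. An alignment of a finite set $V$ is a family $\mathcal{M}$ of subsets of $V$ closed under intersection and containing $\emptyset$ and $V$; its members are called convex sets. The convex hull of $S\subseteq V$ is the smallest convex set containing $S$. For $X\in\mathcal{M}$, $x\in X$ is an extreme point of $X$ if $X\setminus\{x\}\in\mathcal{M}$. $(V,\mathcal{M})$ is a convex geometry if every convex set is the convex hull of its set of extreme points. The $A$-graph is the graph on six vertices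 $a,b,u_1,u_2,u_3,u_4$ with edge set $\{u_1u_2,u_2u_3,u_3u_4,u_4u_1,au_1,bu_4\}$ (an induced $4$-cycle with a pendant vertex attached to each of two adjacent cycle vertices). $G$ is $F$-free if it has no induced subgraph isomorphic to $F$. *)

theory Defs
  imports Main
begin

definition graph :: "'a set \<Rightarrow> ('a \<Rightarrow> 'a \<Rightarrow> bool) \<Rightarrow> bool" where
  "graph V E \<longleftrightarrow> finite V \<and> (\<forall>x y. E x y \<longrightarrow> x \<in> V \<and> y \<in> V)
     \<and> (\<forall>x y. E x y \<longrightarrow> E y x) \<and> (\<forall>x. \<not> E x x)"

definition reach :: "('a \<Rightarrow> 'a \<Rightarrow> bool) \<Rightarrow> 'a set \<Rightarrow> 'a \<Rightarrow> 'a \<Rightarrow> bool" where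
  "reach E W x y \<longleftrightarrow> (\<lambda>a b. E a b \<and> a \<in> W \<and> b \<in> W)\<^sup>*\<^sup>* x y"

definition connected_graph :: "'a set \<Rightarrow> ('a \<Rightarrow> 'a \<Rightarrow> bool) \<Rightarrow> bool" where
  "connected_graph V E \<longleftrightarrow> V \<noteq> {} \<and> (\<forall>x\<in>V. \<forall>y\<in>V. reach E V x y)"

definition components :: "('a \<Rightarrow> 'a \<Rightarrow> bool) \<Rightarrow> 'a set \<Rightarrow> 'a set set" where
  "components E W = {{y \<in> W. reach E W x y} | x. x \<in> W}"

definition cut_vertex :: "('a \<Rightarrow> 'a \<Rightarrow> bool) \<Rightarrow> 'a set \<Rightarrow> 'a \<Rightarrow> bool" where
  "cut_vertex E W x \<longleftrightarrow> x \<in> W \<and> card (components E (W - {x})) > card (components E W)"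

text \<open>Paths are lists of vertices; the length of a path is (length of list - 1).\<close>
definition is_path :: "'a set \<Rightarrow> ('a \<Rightarrow> 'a \<Rightarrow> bool) \<Rightarrow> 'a list \<Rightarrow> bool" where
  "is_path V E p \<longleftrightarrow> p \<noteq> [] \<and> distinct p \<and> set p \<subseteq> V
     \<and> (\<forall>i. Suc i < length p \<longrightarrow> E (p ! i) (p ! Suc i))"

definition induced_path :: "'a set \<Rightarrow> ('a \<Rightarrow> 'a \<Rightarrow> bool) \<Rightarrow> 'a list \<Rightarrow> bool" where
  "induced_path V E p \<longleftrightarrow> is_path V E p
     \<and> (\<forall>i j. i < length p \<and> j < length p \<and> Suc i < j \<longrightarrow> \<not> E (p ! i) (p ! j))"

definition m3_interval :: "'a set \<Rightarrow> ('a \<Rightarrow> 'a \<Rightarrow> bool) \<Rightarrow> 'a \<Rightarrow> 'a \<Rightarrow> 'a set" where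
  "m3_interval V E u v = {x. \<exists>p. induced_path V E p \<and> hd p = u \<and> last p = v
       \<and> length p - 1 \<ge> 3 \<and> x \<in> set p}"

definition m3_convex :: "'a set \<Rightarrow> ('a \<Rightarrow> 'a \<Rightarrow> bool) \<Rightarrow> 'a set \<Rightarrow> bool" where
  "m3_convex V E S \<longleftrightarrow> (\<forall>u\<in>S. \<forall>v\<in>S. m3_interval V E u v \<subseteq> S)"

definition subgraph :: "'a set \<Rightarrow> ('a \<Rightarrow> 'a \<Rightarrow> bool) \<Rightarrow> 'a set \<Rightarrow> ('a \<Rightarrow> 'a \<Rightarrow> bool) \<Rightarrow> bool" where
  "subgraph V E W F \<longleftrightarrow> W \<subseteq> V \<and> (\<forall>x y. F x y \<longrightarrow> E x y \<and> x \<in> W \<and> y \<in> W)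
     \<and> (\<forall>x y. F x y \<longrightarrow> F y x)"

definition has_cycle :: "('a \<Rightarrow> 'a \<Rightarrow> bool) \<Rightarrow> bool" where
  "has_cycle F \<longleftrightarrow> (\<exists>c. length c \<ge> 3 \<and> distinct c
      \<and> (\<forall>i. Suc i < length c \<longrightarrow> F (c ! i) (c ! Suc i)) \<and> F (last c) (hd c))"

definition is_tree :: "'a set \<Rightarrow> ('a \<Rightarrow> 'a \<Rightarrow> bool) \<Rightarrow> bool" where
  "is_tree W F \<longleftrightarrow> connected_graph W F \<and> \<not> has_cycle F"

definition minimal_tree :: "'a set \<Rightarrow> ('a \<Rightarrow> 'a \<Rightarrow> bool) \<Rightarrow> 'a set \<Rightarrow> 'a set \<Rightarrow> ('a \<Rightarrow> 'a \<Rightarrow> bool) \<Rightarrow> bool" where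
  "minimal_tree V E U W F \<longleftrightarrow> subgraph V E W F \<and> U \<subseteq> W \<and> is_tree W F
     \<and> (\<forall>x \<in> W - U. cut_vertex E W x)"

definition mono_interval_set :: "'a set \<Rightarrow> ('a \<Rightarrow> 'a \<Rightarrow> bool) \<Rightarrow> 'a set \<Rightarrow> 'a set" where
  "mono_interval_set V E U = \<Union>{W. \<exists>F. minimal_tree V E U W F}"

definition m_3_convex :: "'a set \<Rightarrow> ('a \<Rightarrow> 'a \<Rightarrow> bool) \<Rightarrow> 'a set \<Rightarrow> bool" where
  "m_3_convex V E S \<longleftrightarrow> (\<forall>U. U \<subseteq> S \<and> card U = 3 \<longrightarrow> mono_interval_set V E U \<subseteq> S)"

definition m33_convex :: "'a set \<Rightarrow> ('a \<Rightarrow> 'a \<Rightarrow> bool) \<Rightarrow> 'a set \<Rightarrow> bool" where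
  "m33_convex V E S \<longleftrightarrow> m3_convex V E S \<and> m_3_convex V E S"

definition m33_convex_sets :: "'a set \<Rightarrow> ('a \<Rightarrow> 'a \<Rightarrow> bool) \<Rightarrow> 'a set set" where
  "m33_convex_sets V E = {S. S \<subseteq> V \<and> m33_convex V E S}"

definition alignment :: "'a set \<Rightarrow> 'a set set \<Rightarrow> bool" where
  "alignment V M \<longleftrightarrow> M \<subseteq> Pow V \<and> {} \<in> M \<and> V \<in> M \<and> (\<forall>A\<in>M. \<forall>B\<in>M. A \<inter> B \<in> M)"

definition convex_hull_in :: "'a set set \<Rightarrow> 'a set \<Rightarrow> 'a set" where
  "convex_hull_in M S = \<Inter>{C \<in> M. S \<subseteq> C}"

definition extreme_points :: "'a set set \<Rightarrow> 'a set \<Rightarrow> 'a set" where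
  "extreme_points M X = {x \<in> X. X - {x} \<in> M}"

definition convex_geometry :: "'a set \<Rightarrow> 'a set set \<Rightarrow> bool" where
  "convex_geometry V M \<longleftrightarrow> alignment V M
     \<and> (\<forall>X\<in>M. X = convex_hull_in M (extreme_points M X))"

text \<open>The A-graph on {0..5}: 0 = a, 1 = b, 2,3,4,5 = u1,u2,u3,u4.\<close>
definition A_vertices :: "nat set" where "A_vertices = {0..5}"

definition A_edge :: "nat \<Rightarrow> nat \<Rightarrow> bool" where
  "A_edge x y \<longleftrightarrow> {x, y} \<in> {{2,3}, {3,4}, {4,5}, {5,2}, {0,2}, {1,5}}"

definition has_induced :: "'a set \<Rightarrow> ('a \<Rightarrow> 'a \<Rightarrow> bool) \<Rightarrow> 'b set \<Rightarrow> ('b \<Rightarrow> 'b \<Rightarrow> bool) \<Rightarrow> bool" where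
  "has_induced V E H EH \<longleftrightarrow> (\<exists>f. inj_on f H \<and> f ` H \<subseteq> V
      \<and> (\<forall>x\<in>H. \<forall>y\<in>H. E (f x) (f y) \<longleftrightarrow> EH x y))"

definition A_free :: "'a set \<Rightarrow> ('a \<Rightarrow> 'a \<Rightarrow> bool) \<Rightarrow> bool" where
  "A_free V E \<longleftrightarrow> \<not> has_induced V E A_vertices A_edge"

end

theory Submission
  imports Defs
begin

text \<open>
  Inner vertices of an induced \<open>P4\<close> inside a convex set are never extreme in it. Hence the hull of a house
  would have at most one extreme point, so there is no induced house; and the hull of an induced
  \<open>A\<close>-graph with pendant vertices \<open>a\<close>, \<open>b\<close> equals the hull \<open>X\<close> of \<open>{a, b}\<close>, with \<open>a\<close>, \<open>b\<close> extreme.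
  Choose an \<open>A\<close>-graph with \<open>X\<close> of minimal size. Then \<open>b\<close> is not a pendant vertex, together with some
  \<open>s \<noteq> a\<close>, of another \<open>A\<close>-graph inside \<open>X\<close>, and the exclusion of houses makes any two nonadjacent
  vertices of \<open>N = N(a) \<union> N(b)\<close> (neighbourhoods taken in \<open>X\<close>) two neighbours of \<open>a\<close> or two
  neighbours of \<open>b\<close>. Since \<open>a\<close> and \<open>b\<close> are extreme, \<open>N\<close> is therefore a clique minus a matching whose
  nonadjacent pairs have the same neighbours in \<open>X\<close>. This makes \<open>K = N \<union> {a, b}\<close> convex: an induced
  path leaving \<open>K\<close> and returning has length 2, and a minimal tree on a 3-subset of \<open>K\<close> meets \<open>K\<close> in a
  connected set. But \<open>K\<close> contains \<open>a\<close> and \<open>b\<close> and misses the cycle vertices adjacent to neither,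
  although \<open>X\<close> is the hull of \<open>{a, b}\<close>.
\<close>

section \<open>Reachability, components and cut vertices\<close>

lemma reach_refl: "reach E W x x"
  by (simp add: reach_def)

lemma reach_edge: "E x y \<Longrightarrow> x \<in> W \<Longrightarrow> y \<in> W \<Longrightarrow> reach E W x y"
  by (auto simp: reach_def)

lemma reach_trans: "reach E W x y \<Longrightarrow> reach E W y z \<Longrightarrow> reach E W x z"
  unfolding reach_def by (rule rtranclp_trans)

lemma reach_mono:
  assumes "reach F W x y" "\<And>a b. F a b \<Longrightarrow> E a b" "W \<subseteq> W'"
  shows "reach E W' x y"
  using assms(1) unfolding reach_def
  by (rule rtranclp_mono[THEN predicate2D, rotated]) (use assms(2,3) in auto)

lemma reach_sym:
  assumes "\<And>x y. E x y \<Longrightarrow> E y x" "reach E W x y"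
  shows "reach E W y x"
  using assms(2) unfolding reach_def
  by (induction rule: rtranclp_induct)
    (auto intro: converse_rtranclp_into_rtranclp assms(1))

lemma reach_exit:
  assumes "reach E W x y" "x \<in> C" "y \<notin> C"
  shows "\<exists>p q. p \<in> C \<and> p \<in> W \<and> q \<in> W - C \<and> E p q"
  using assms unfolding reach_def
  by (induction rule: rtranclp_induct) auto

lemma reach_closed:
  assumes "reach E W x y" "\<And>p q. p \<in> C \<Longrightarrow> p \<in> W \<Longrightarrow> q \<in> W \<Longrightarrow> E p q \<Longrightarrow> q \<in> C" "x \<in> C"
  shows "y \<in> C"
  using reach_exit[OF assms(1,3)] assms(2) by blast

lemma components_connected:
  assumes "connected_graph W E"
  shows "components E W = {W}"
  using assms unfolding components_def connected_graph_def by blast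

text \<open>A connected proper subset of \<open>W\<close> can be enlarged one vertex at a time up to \<open>W\<close>;
  the vertex added last is not a cut vertex.\<close>

lemma non_cut_vertex_outside:
  assumes sym: "\<And>x y. E x y \<Longrightarrow> E y x"
    and W: "connected_graph W E" "finite W"
    and C: "connected_graph C E" "C \<subset> W"
  shows "\<exists>x\<in>W - C. \<not> cut_vertex E W x"
  using C
proof (induction "card (W - C)" arbitrary: C rule: less_induct)
  case less
  obtain c y where "c \<in> C" "y \<in> W - C"
    using less.prems unfolding connected_graph_def by blast
  then obtain p x where px: "p \<in> C" "x \<in> W - C" "E p x"
    using reach_exit[of E W c y C] W(1) less.prems(2) unfolding connected_graph_def by blast
  let ?D = "insert x C"
  have px_reach: "reach E ?D p x" "reach E ?D x p"
    using px by (auto intro!: reach_edge intro: sym)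
  have in_C: "reach E ?D u v" if "u \<in> C" "v \<in> C" for u v
    using that less.prems(1) reach_mono[of E C u v E ?D]
    unfolding connected_graph_def by blast
  have D: "connected_graph ?D E"
    unfolding connected_graph_def
    by (auto intro: reach_refl in_C reach_trans[OF in_C px_reach(1)] reach_trans[OF px_reach(2) in_C]
        simp: px(1))
  show ?case
  proof (cases "?D = W")
    case True
    then have "W - {x} = C"
      using px(2) by blast
    then have "\<not> cut_vertex E W x"
      using components_connected[OF W(1)] components_connected[OF less.prems(1)]
      by (simp add: cut_vertex_def)
    then show ?thesis
      using px(2) by blast
  next
    case False
    then have "?D \<subset> W"
      using px(2) less.prems(2) by blast
    moreover have "card (W - ?D) < card (W - C)"
      by (rule psubset_card_mono) (use W(2) px(2) in auto)
    ultimately show ?thesis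
      using less.hyps D by blast
  qed
qed

section \<open>Convexity of intersections and singletons\<close>

lemma m33_convex_Inter:
  assumes "\<And>C. C \<in> F \<Longrightarrow> m33_convex V E C"
  shows "m33_convex V E (\<Inter>F)"
  unfolding m33_convex_def m3_convex_def m_3_convex_def
proof (intro conjI ballI allI impI)
  fix u v
  assume "u \<in> \<Inter>F" "v \<in> \<Inter>F"
  then show "m3_interval V E u v \<subseteq> \<Inter>F"
    using assms unfolding m33_convex_def m3_convex_def by (meson Inter_greatest InterE)
next
  fix U
  assume "U \<subseteq> \<Inter>F \<and> card U = 3"
  then show "mono_interval_set V E U \<subseteq> \<Inter>F"
    using assms unfolding m33_convex_def m_3_convex_def by (meson Inter_greatest le_Inf_iff)
qed

lemma m33_convex_singleton:
  fixes x :: 'a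
  shows "m33_convex V E {x}"
  unfolding m33_convex_def m3_convex_def m_3_convex_def
proof (intro conjI ballI allI impI)
  fix u v
  assume "u \<in> {x}" "v \<in> {x}"
  then have uv: "u = v"
    by simp
  have "hd p \<noteq> last p" if "distinct p" "length p - 1 \<ge> 3" for p :: "'a list"
    using that by (cases p) auto
  then have False if "y \<in> m3_interval V E u v" for y
    using that unfolding m3_interval_def induced_path_def is_path_def uv mem_Collect_eq by metis
  then show "m3_interval V E u v \<subseteq> {x}"
    by blast
next
  fix U
  assume U: "U \<subseteq> {x} \<and> card U = 3"
  then have "card U \<le> card {x}"
    by (intro card_mono) auto
  with U show "mono_interval_set V E U \<subseteq> {x}"
    by simp
qed

section \<open>Hulls and extreme points\<close>

locale m33_geometry =
  fixes V :: "'a set" and E :: "'a \<Rightarrow> 'a \<Rightarrow> bool"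
  assumes graph: "graph V E"
    and geometry: "convex_geometry V (m33_convex_sets V E)"
begin

abbreviation "M \<equiv> m33_convex_sets V E"
abbreviation "hull \<equiv> convex_hull_in M"
abbreviation "ext \<equiv> extreme_points M"

lemma sym: "E x y \<Longrightarrow> E y x"
  and irrefl: "\<not> E x x"
  and in_V: "E x y \<Longrightarrow> x \<in> V" "E x y \<Longrightarrow> y \<in> V"
  and finite_V: "finite V"
  using graph by (auto simp: graph_def)

lemma sym_iff: "E x y \<longleftrightarrow> E y x"
  using sym by blast

lemma V_convex: "V \<in> M"
  using geometry by (auto simp: convex_geometry_def alignment_def)

lemma convex_subset: "X \<in> M \<Longrightarrow> X \<subseteq> V"
  by (simp add: m33_convex_sets_def)

lemma hull_minimal: "S \<subseteq> C \<Longrightarrow> C \<in> M \<Longrightarrow> hull S \<subseteq> C"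
  by (auto simp: convex_hull_in_def)

lemma subset_hull: "S \<subseteq> hull S"
  by (auto simp: convex_hull_in_def)

lemma hull_convex:
  assumes "S \<subseteq> V"
  shows "hull S \<in> M"
proof -
  have "hull S \<subseteq> V"
    using hull_minimal assms V_convex .
  moreover have "m33_convex V E (hull S)"
    unfolding convex_hull_in_def by (rule m33_convex_Inter) (simp add: m33_convex_sets_def)
  ultimately show ?thesis
    by (simp add: m33_convex_sets_def)
qed

lemma hull_ext: "X \<in> M \<Longrightarrow> hull (ext X) = X"
  using geometry by (auto simp: convex_geometry_def)

text \<open>A point outside \<open>S\<close> that is extreme in the hull could be deleted, leaving a
  smaller convex set around \<open>S\<close>.\<close>

lemma ext_hull_subset:
  assumes "S \<subseteq> V"
  shows "ext (hull S) \<subseteq> S"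
proof
  fix x
  assume x: "x \<in> ext (hull S)"
  show "x \<in> S"
  proof (rule ccontr)
    assume "x \<notin> S"
    then have "hull S \<subseteq> hull S - {x}"
      using x subset_hull[of S] by (intro hull_minimal) (auto simp: extreme_points_def)
    then show False
      using x by (auto simp: extreme_points_def)
  qed
qed

text \<open>Singletons are convex. Used contrapositively: a convex set with two vertices has two
  extreme points.\<close>

lemma ext_not_singleton:
  assumes "X \<in> M" "ext X \<subseteq> {x}" "x \<in> V"
  shows "X \<subseteq> {x}"
  using hull_minimal[OF assms(2)] hull_ext[OF assms(1)] assms(3)
  by (simp add: m33_convex_sets_def m33_convex_singleton)

section \<open>Obstructions to being extreme\<close>

lemma P4_in_m3_interval:
  assumes "E x y" "E y z" "E z w" "\<not> E x z" "\<not> E y w" "\<not> E x w"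
  shows "{x, y, z, w} \<subseteq> m3_interval V E x w"
proof -
  have d: "distinct [x, y, z, w]"
    using assms irrefl by (auto dest: sym)
  have "is_path V E [x, y, z, w]"
    using assms d in_V unfolding is_path_def
    by (auto simp: less_Suc_eq nth_Cons split: nat.split)
  then have "induced_path V E [x, y, z, w]"
    using assms unfolding induced_path_def
    by (auto simp: less_Suc_eq nth_Cons split: nat.split)
  then show ?thesis
    unfolding m3_interval_def by (intro subsetI CollectI exI[of _ "[x, y, z, w]"]) simp
qed

lemma P4_not_ext:
  assumes "E x y" "E y z" "E z w" "\<not> E x z" "\<not> E y w" "\<not> E x w" "x \<in> X" "w \<in> X"
  shows "y \<notin> ext X" "z \<notin> ext X"
proof -
  have ne: "y \<noteq> x" "y \<noteq> w" "z \<noteq> x" "z \<noteq> w"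
    using assms irrefl by (auto dest: sym)
  have "v \<notin> ext X" if "v \<in> {y, z}" for v
  proof
    assume "v \<in> ext X"
    then have "m3_convex V E (X - {v})"
      by (auto simp: extreme_points_def m33_convex_sets_def m33_convex_def)
    then have "m3_interval V E x w \<subseteq> X - {v}"
      using assms(7,8) ne that unfolding m3_convex_def by blast
    then show False
      using P4_in_m3_interval[OF assms(1-6)] that by blast
  qed
  then show "y \<notin> ext X" "z \<notin> ext X"
    by auto
qed

text \<open>The star centred at \<open>a\<close> is a minimal tree: \<open>y\<close> is isolated
  among the three leaves, so deleting \<open>a\<close> disconnects them. An edge \<open>z w\<close>
  does no harm.\<close>

lemma claw_in_mono_interval:
  assumes "E a y" "E a z" "E a w" "distinct [y, z, w]" "\<not> E y z" "\<not> E y w"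
  shows "a \<in> mono_interval_set V E {y, z, w}"
proof -
  let ?U = "{y, z, w}"
  let ?W = "insert a ?U"
  let ?F = "\<lambda>p q. (p = a \<and> q \<in> ?U) \<or> (q = a \<and> p \<in> ?U)"
  have a: "a \<notin> ?U"
    using assms irrefl by auto
  have F_E: "E p q" if "?F p q" for p q
    using that assms(1-3) by (auto intro: sym)
  have star: "reach ?F ?W a v" "reach ?F ?W v a" if "v \<in> ?W" for v
  proof -
    have "v = a \<or> ?F a v \<and> ?F v a"
      using that by blast
    moreover have "reach ?F ?W a v \<and> reach ?F ?W v a" if "?F a v" "?F v a"
      using that \<open>v \<in> ?W\<close> reach_edge[of ?F a v ?W] reach_edge[of ?F v a ?W] by blast
    ultimately show "reach ?F ?W a v" "reach ?F ?W v a"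
      using reach_refl[of ?F ?W a] by blast+
  qed
  have conn: "connected_graph ?W ?F"
    unfolding connected_graph_def by (auto simp del: insert_iff intro: reach_trans[OF star(2,1)])
  have "\<not> has_cycle ?F"
  proof
    assume "has_cycle ?F"
    then obtain c where c: "length c \<ge> 3" "distinct c"
      "\<And>i. Suc i < length c \<Longrightarrow> ?F (c ! i) (c ! Suc i)" "?F (last c) (hd c)"
      unfolding has_cycle_def by blast
    obtain p q r cs where cs: "c = p # q # r # cs"
      using c(1) by (metis Suc_le_length_iff numeral_3_eq_3)
    \<comment> \<open>Every edge of the star contains \<open>a\<close>, but no vertex lies on all of
      \<open>p q\<close>, \<open>q r\<close> and the closing edge at \<open>p\<close>.\<close>
    have 1: "?F p q" "?F q r"
      using c(3)[of 0] c(3)[of 1] cs by auto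
    have "last c \<noteq> p" "last c \<noteq> q"
      using cs c(2) by auto
    moreover have "hd c = p"
      using cs by simp
    ultimately show False
      using 1 c(2,4) cs a by auto
  qed
  moreover have "cut_vertex E ?W a"
  proof -
    have "connected_graph ?W E"
      unfolding connected_graph_def
    proof (intro conjI ballI)
      fix u v
      assume "u \<in> ?W" "v \<in> ?W"
      then have "reach ?F ?W u v"
        using conn unfolding connected_graph_def by blast
      then show "reach E ?W u v"
        by (rule reach_mono) (use F_E in auto)
    qed simp
    then have "card (components E ?W) = 1"
      by (simp add: components_connected)
    moreover have "card (components E (?W - {a})) \<ge> 2"
    proof -
      have "?W - {a} = ?U"
        using a by auto
      moreover have "card (components E ?U) \<ge> 2"
      proof -
        let ?C = "\<lambda>x. {v \<in> ?U. reach E ?U x v}"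
        have "\<not> reach E ?U y z"
        proof
          assume r: "reach E ?U y z"
          have "z \<in> {y}"
            by (rule reach_closed[OF r]) (use assms(5,6) irrefl in auto)
          then show False
            using assms(4) by simp
        qed
        then have "z \<in> ?C z - ?C y"
          using reach_refl[of E ?U z] by simp
        then have "?C y \<noteq> ?C z"
          by blast
        moreover have "{?C y, ?C z} \<subseteq> components E ?U"
          unfolding components_def by blast
        moreover have "finite (components E ?U)"
          unfolding components_def by (simp add: Setcompr_eq_image)
        ultimately show ?thesis
          using card_mono[of "components E ?U" "{?C y, ?C z}"] by simp
      qed
      ultimately show ?thesis
        by simp
    qed
    ultimately show ?thesis
      by (simp add: cut_vertex_def)
  qed
  moreover have "subgraph V E ?W ?F"
    using in_V[OF assms(1)] in_V[OF assms(2)] in_V[OF assms(3)] F_E unfolding subgraph_def by auto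
  ultimately have "minimal_tree V E ?U ?W ?F"
    using conn unfolding minimal_tree_def is_tree_def by auto
  then show ?thesis
    unfolding mono_interval_set_def by blast
qed

text \<open>Otherwise \<open>a\<close> lies in the interval of a 3-subset of the convex set
  \<open>X - {a}\<close>.\<close>

lemma ext_neighbours:
  assumes "a \<in> ext X" "E a y" "E a z" "E a w" "y \<in> X" "z \<in> X" "w \<in> X" "distinct [y, z, w]"
  shows "E y z \<or> E y w"
proof (rule ccontr)
  assume "\<not> ?thesis"
  then have "a \<in> mono_interval_set V E {y, z, w}"
    using assms by (intro claw_in_mono_interval) auto
  moreover have "m_3_convex V E (X - {a})"
    using assms(1) by (auto simp: extreme_points_def m33_convex_sets_def m33_convex_def)
  moreover have "{y, z, w} \<subseteq> X - {a}" "card {y, z, w} = 3"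
    using assms irrefl by auto
  ultimately show False
    unfolding m_3_convex_def by blast
qed

text \<open>If not, either \<open>w\<close> is a neighbour of \<open>a\<close> and \<open>z\<close>
  misses both \<open>y\<close> and \<open>w\<close>, or \<open>z a y w\<close> is an induced path
  with inner vertex \<open>a\<close>.\<close>

lemma ext_neighbours_twins:
  assumes a: "a \<in> ext X" and yz: "E a y" "E a z" "y \<in> X" "z \<in> X" "y \<noteq> z" "\<not> E y z"
    and w: "w \<in> X" "E w y"
  shows "E w z"
proof (rule ccontr)
  assume n: "\<not> E w z"
  have "w \<noteq> a" "w \<noteq> y" "w \<noteq> z"
    using n w yz irrefl by (auto dest: sym)
  show False
  proof (cases "E a w")
    case True
    then show False
      using ext_neighbours[OF a yz(2,1) True yz(4,3) w(1)] \<open>w \<noteq> y\<close> \<open>w \<noteq> z\<close> yz(5,6) n by (auto dest: sym)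
  next
    case False
    then show False
      using P4_not_ext(1)[of z a y w X] yz w a n sym by blast
  qed
qed

text \<open>No house with roof \<open>r\<close> over the edge \<open>p q\<close> of the 4-cycle \<open>p q t s\<close>:
  all its vertices except \<open>r\<close> are inner vertices of an induced \<open>P4\<close>.\<close>

lemma house_free:
  assumes "E r p" "E r q" "E p q" "E q t" "E t s" "E s p"
    and "\<not> E p t" "\<not> E q s" "\<not> E r t"
  shows "E r s"
proof (rule ccontr)
  assume n: "\<not> E r s"
  let ?S = "{r, p, q, t, s}"
  have S: "?S \<subseteq> V"
    using assms in_V by blast
  note H = subset_hull[of ?S]
  have "p \<notin> ext (hull ?S)" "s \<notin> ext (hull ?S)"
    using P4_not_ext[of r p s t "hull ?S"] assms n sym H by blast+
  moreover have "q \<notin> ext (hull ?S)" "t \<notin> ext (hull ?S)"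
    using P4_not_ext[of r q t s "hull ?S"] assms n sym H by blast+
  ultimately have "ext (hull ?S) \<subseteq> {r}"
    using ext_hull_subset[OF S] by blast
  then have "hull ?S \<subseteq> {r}"
    using ext_not_singleton hull_convex[OF S] S by blast
  then show False
    using H assms(1) irrefl by blast
qed

section \<open>Induced A-graphs\<close>

text \<open>Distinctness is implied: any two of the six vertices are adjacent or have different
  neighbourhoods.\<close>

definition A_config :: "'a \<Rightarrow> 'a \<Rightarrow> 'a \<Rightarrow> 'a \<Rightarrow> 'a \<Rightarrow> 'a \<Rightarrow> bool" where
  "A_config a b u1 u2 u3 u4 \<longleftrightarrow>
     E a u1 \<and> E b u4 \<and> E u1 u2 \<and> E u2 u3 \<and> E u3 u4 \<and> E u4 u1 \<and>
     \<not> E a b \<and> \<not> E a u2 \<and> \<not> E a u3 \<and> \<not> E a u4 \<and>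
     \<not> E b u1 \<and> \<not> E b u2 \<and> \<not> E b u3 \<and> \<not> E u1 u3 \<and> \<not> E u2 u4"

lemma A_config_swap: "A_config a b u1 u2 u3 u4 \<Longrightarrow> A_config b a u4 u3 u2 u1"
  unfolding A_config_def by (simp add: sym_iff)

lemma A_config_in_V: "A_config a b u1 u2 u3 u4 \<Longrightarrow> {a, b, u1, u2, u3, u4} \<subseteq> V"
  unfolding A_config_def by (auto dest: in_V)

text \<open>\<open>u1\<close> and \<open>u4\<close> are inner on \<open>a u1 u4 b\<close>,
  \<open>u2\<close> on \<open>a u1 u2 u3\<close>, \<open>u3\<close> on \<open>b u4 u3 u2\<close>.
  Only \<open>a\<close> and \<open>b\<close> can be extreme in the hull of all six, and one of them
  alone does not span it.\<close>

lemma A_config_hull: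
  assumes "A_config a b u1 u2 u3 u4"
  shows "{u1, u2, u3, u4} \<subseteq> hull {a, b}" "a \<in> ext (hull {a, b})" "b \<in> ext (hull {a, b})"
proof -
  let ?S = "{a, b, u1, u2, u3, u4}"
  note A = assms[unfolded A_config_def]
  note S = A_config_in_V[OF assms]
  note H = subset_hull[of ?S] and HM = hull_convex[OF S]
  have "u1 \<notin> ext (hull ?S)" "u4 \<notin> ext (hull ?S)"
    using P4_not_ext[of a u1 u4 b "hull ?S"] A sym H by blast+
  moreover have "u2 \<notin> ext (hull ?S)"
    using P4_not_ext(2)[of a u1 u2 u3 "hull ?S"] A sym H by blast
  moreover have "u3 \<notin> ext (hull ?S)"
    using P4_not_ext(2)[of b u4 u3 u2 "hull ?S"] A sym H by blast
  ultimately have ext: "ext (hull ?S) \<subseteq> {a, b}"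
    using ext_hull_subset[OF S] by blast
  have "a \<noteq> b"
    using A by blast
  have "hull {a, b} \<subseteq> hull ?S"
    by (rule hull_minimal) (use H HM in auto)
  moreover have "hull (ext (hull ?S)) \<subseteq> hull {a, b}"
    by (rule hull_minimal) (use ext subset_hull[of "{a, b}"] hull_convex S in auto)
  ultimately have eq: "hull ?S = hull {a, b}"
    using hull_ext[OF HM] by simp
  then show "{u1, u2, u3, u4} \<subseteq> hull {a, b}"
    using H by simp
  have "\<not> ext (hull ?S) \<subseteq> {x}" if "x \<in> {a, b}" for x
    using ext_not_singleton[OF HM, of x] that S H \<open>a \<noteq> b\<close> by blast
  then have "\<not> ext (hull ?S) \<subseteq> {a}" "\<not> ext (hull ?S) \<subseteq> {b}"
    by blast+
  then show "a \<in> ext (hull {a, b})" "b \<in> ext (hull {a, b})"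
    using ext eq by auto
qed

end

text \<open>The configurations of smallest hull \<open>X\<close>; the two pendant vertices are extreme in \<open>X\<close>, so a
  configuration inside \<open>X\<close> with other pendant vertices would have a smaller hull.\<close>

locale m33_geometry_minimal_A = m33_geometry +
  fixes a b :: 'a
  assumes config_exists: "\<exists>u1 u2 u3 u4. A_config a b u1 u2 u3 u4"
    and minimal: "A_config a' b' v1 v2 v3 v4 \<Longrightarrow> card (hull {a, b}) \<le> card (hull {a', b'})"
begin

abbreviation "X \<equiv> hull {a, b}"

lemma in_X: "a \<in> X" "b \<in> X"
  using subset_hull[of "{a, b}"] by auto

lemma X_convex: "X \<in> M"
proof -
  obtain u1 u2 u3 u4 where "A_config a b u1 u2 u3 u4"
    using config_exists by blast
  from A_config_in_V[OF this] show ?thesis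
    by (intro hull_convex) simp
qed

lemma ext_X: "a \<in> ext X" "b \<in> ext X"
proof -
  obtain u1 u2 u3 u4 where "A_config a b u1 u2 u3 u4"
    using config_exists by blast
  from A_config_hull(2,3)[OF this] show "a \<in> ext X" "b \<in> ext X" .
qed

text \<open>Reversing the cycle exchanges the pendant vertices, so facts about \<open>a\<close>
  transfer to \<open>b\<close>.\<close>

lemma swapped: "m33_geometry_minimal_A V E b a"
proof unfold_locales
  show "\<exists>u1 u2 u3 u4. A_config b a u1 u2 u3 u4"
    using config_exists A_config_swap by blast
  show "card (hull {b, a}) \<le> card (hull {a', b'})" if "A_config a' b' v1 v2 v3 v4"
    for a' b' v1 v2 v3 v4
    using minimal[OF that] by (simp add: insert_commute)
qed

section \<open>Neighbours of the pendant vertices of a minimal configuration\<close>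

lemma pendant_forced:
  assumes "A_config s b u1 u2 u3 u4" "s \<in> X"
  shows "s = a"
proof (rule ccontr)
  assume ne: "s \<noteq> a"
  obtain v1 v2 v3 v4 where "A_config a b v1 v2 v3 v4"
    using config_exists by blast
  then have "a \<noteq> b"
    unfolding A_config_def by blast
  have "hull {s, b} \<subseteq> X - {a}"
    using ext_X(1) assms(2) in_X ne \<open>a \<noteq> b\<close> by (intro hull_minimal) (auto simp: extreme_points_def)
  then have "hull {s, b} \<subset> X"
    using in_X by blast
  then have "card (hull {s, b}) < card X"
    using finite_subset[OF convex_subset[OF X_convex] finite_V] by (rule psubset_card_mono[rotated])
  then show False
    using minimal[OF assms(1)] by simp
qed

text \<open>Otherwise \<open>s\<close> could replace \<open>a\<close> as pendant vertex: twins give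
  \<open>E s u1\<close>, and an edge from \<open>s\<close> to \<open>u3\<close>, \<open>u2\<close>
  or \<open>b\<close> would create a house.\<close>

lemma neighbour_adjacent:
  assumes cfg: "A_config a b u1 u2 u3 u4" and s: "s \<in> X" "E a s"
  shows "E s u4"
proof (rule ccontr)
  assume n4: "\<not> E s u4"
  note A = cfg[unfolded A_config_def]
  have u: "u1 \<in> X" "u2 \<in> X" "u3 \<in> X" "u4 \<in> X"
    using A_config_hull(1)[OF cfg] by auto
  have "s \<noteq> u1"
    using A n4 sym by blast
  have s1: "E s u1"
    using ext_neighbours_twins[OF ext_X(1), of u1 s u4] A s u n4 \<open>s \<noteq> u1\<close> sym by blast
  have n3: "\<not> E s u3"
    using house_free[of a s u1 u4 u3] A s s1 n4 sym by blast
  have n2: "\<not> E s u2"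
    using house_free[of s u2 u1 u4 u3] A s1 n3 n4 sym by blast
  have nb: "\<not> E s b"
    using house_free[of a s u1 u4 b] A s s1 n4 sym by blast
  have "A_config s b u1 u2 u3 u4"
    unfolding A_config_def using A s1 n2 n3 n4 nb by blast
  then show False
    using pendant_forced s irrefl by blast
qed

lemma neighbour_adjacent':
  assumes "A_config a b u1 u2 u3 u4" "t \<in> X" "E b t"
  shows "E t u1"
  using m33_geometry_minimal_A.neighbour_adjacent[OF swapped A_config_swap[OF assms(1)]] assms(2,3)
  by (simp add: insert_commute)

lemma nonadjacent_common:
  assumes s: "s \<in> X" "E a s" and t: "t \<in> X" "E b t" and ne: "s \<noteq> t" and n: "\<not> E s t"
  shows "E b s \<or> E a t"
proof (rule ccontr)
  assume n': "\<not> ?thesis"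
  obtain u1 u2 u3 u4 where cfg: "A_config a b u1 u2 u3 u4"
    using config_exists by blast
  note A = cfg[unfolded A_config_def]
  have u: "u1 \<in> X" "u2 \<in> X" "u3 \<in> X" "u4 \<in> X"
    using A_config_hull(1)[OF cfg] by auto
  have s4: "E s u4" and t1: "E t u1"
    using neighbour_adjacent[OF cfg s] neighbour_adjacent'[OF cfg t] .
  have ne1: "s \<noteq> u1" and ne4: "t \<noteq> u4"
    using n t1 s4 sym by blast+
  have s1: "E s u1"
    using ext_neighbours_twins[OF ext_X(1), of u1 s t] A s t u n t1 ne1 sym by blast
  have t4: "E t u4"
    using ext_neighbours_twins[OF ext_X(2), of u4 t s] A s t u n s4 ne4 sym by blast
  \<comment> \<open>If \<open>s\<close> missed \<open>u2\<close>, the house with roof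
    \<open>s\<close> over \<open>u4 u1\<close> would force \<open>E s u3\<close>; then
    \<open>a\<close> is the roof of a house on the cycle \<open>s u1 u2 u3\<close>.\<close>
  have s2: "E s u2"
    using house_free[of a s u1 u2 u3] house_free[of s u4 u1 u2 u3] A s s1 s4 sym by blast
  have t3: "E t u3"
    using house_free[of b t u4 u3 u2] house_free[of t u1 u4 u3 u2] A t t1 t4 sym by blast
  \<comment> \<open>Otherwise \<open>s\<close> can take the place of \<open>u1\<close>, to which
    \<open>t\<close>, a neighbour of \<open>b\<close>, must be adjacent.\<close>
  have s3: "E s u3"
  proof (rule ccontr)
    assume "\<not> E s u3"
    then have "A_config a b s u2 u3 u4"
      unfolding A_config_def using A s s2 s4 n' sym by blast
    from neighbour_adjacent'[OF this t] show False
      using n sym by blast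
  qed
  \<comment> \<open>Now \<open>a\<close> is the roof over \<open>s u1\<close> of a house on the
    cycle \<open>s u1 t u3\<close>.\<close>
  show False
    using house_free[of a s u1 t u3] A s s1 s3 t1 t3 n n' sym by blast
qed

section \<open>Nonadjacent pairs in the neighbourhood of \<open>a\<close> and
  \<open>b\<close>\<close>

definition N where "N = {s \<in> X. E a s \<or> E b s}"

lemma N_iff: "s \<in> N \<longleftrightarrow> s \<in> X \<and> (E a s \<or> E b s)"
  by (simp add: N_def)

lemma N_nonadjacent:
  assumes "s \<in> N" "t \<in> N" "s \<noteq> t" "\<not> E s t"
  shows "(E a s \<and> E a t) \<or> (E b s \<and> E b t)"
proof -
  have "\<not> E t s"
    using assms(4) sym by blast
  then show ?thesis
    using assms nonadjacent_common[of s t] nonadjacent_common[of t s] unfolding N_iff by argo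
qed

lemma N_twins:
  assumes "s \<in> N" "t \<in> N" "s \<noteq> t" "\<not> E s t" "w \<in> X" "E w s"
  shows "E w t"
  using N_nonadjacent[OF assms(1-4)] ext_neighbours_twins[OF ext_X(1) _ _ _ _ assms(3-6)]
    ext_neighbours_twins[OF ext_X(2) _ _ _ _ assms(3-6)] assms(1,2) unfolding N_iff by argo

text \<open>If \<open>s\<close> missed both \<open>t\<close> and \<open>z\<close>, an extreme
  neighbour \<open>c\<close> of \<open>s\<close> would by twins be adjacent to all three, against
  \<open>ext_neighbours\<close>.\<close>

lemma N_third:
  assumes "s \<in> N" "t \<in> N" "s \<noteq> t" "\<not> E s t" "z \<in> N" "z \<noteq> s" "z \<noteq> t"
  shows "E z s"
proof (rule ccontr)
  assume n: "\<not> E z s"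
  have X: "s \<in> X" "t \<in> X" "z \<in> X"
    using assms(1,2,5) unfolding N_def by blast+
  have n': "\<not> E s z"
    using n sym by blast
  obtain c where c: "c \<in> X" "c \<in> ext X" "E c s"
    using assms(1) that[OF in_X(1) ext_X(1)] that[OF in_X(2) ext_X(2)] unfolding N_def by auto
  have "E c t" "E c z"
    using N_twins[OF assms(1-4) c(1,3)] N_twins[OF assms(1,5) assms(6)[symmetric] n' c(1,3)] .
  then show False
    using ext_neighbours[OF c(2,3) _ _ X] assms n' by auto
qed

section \<open>Convexity of the closed neighbourhood of \<open>a\<close> and
  \<open>b\<close>\<close>

definition K where "K = insert a (insert b N)"

text \<open>All neighbours of \<open>a\<close> and \<open>b\<close> in \<open>X\<close> lie in
  \<open>N\<close>, so a path in \<open>X\<close> leaves \<open>K\<close> only through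
  \<open>N\<close>.\<close>

lemma K_boundary:
  assumes "s \<in> K" "E s r" "r \<in> X" "r \<notin> K"
  shows "s \<in> N"
  using assms by (auto simp: K_def N_iff)

lemma K_subset_X: "K \<subseteq> X"
  using in_X by (auto simp: K_def N_iff)

lemma K_m3_convex: "m3_convex V E K"
  unfolding m3_convex_def
proof (intro ballI)
  fix u v
  assume uv: "u \<in> K" "v \<in> K"
  show "m3_interval V E u v \<subseteq> K"
  proof
    fix x
    assume x: "x \<in> m3_interval V E u v"
    then obtain p where p: "induced_path V E p" "hd p = u" "last p = v" "length p - 1 \<ge> 3"
      "x \<in> set p"
      unfolding m3_interval_def by auto
    have "m3_convex V E X"
      using X_convex by (simp add: m33_convex_sets_def m33_convex_def)
    then have "m3_interval V E u v \<subseteq> X"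
      using uv K_subset_X unfolding m3_convex_def by (meson subsetD)
    moreover have "set p \<subseteq> m3_interval V E u v"
      using p unfolding m3_interval_def by auto
    ultimately have p_X: "p ! i \<in> X" if "i < length p" for i
      using nth_mem[OF that] by blast
    have edge: "E (p ! i) (p ! Suc i)" if "Suc i < length p" for i
      using p(1) that unfolding induced_path_def is_path_def by blast
    have non_edge: "\<not> E (p ! i) (p ! j)" if "Suc i < j" "j < length p" for i j
      using p(1) that unfolding induced_path_def by simp
    have "p \<noteq> []" and dist: "distinct p"
      using p(1) unfolding induced_path_def is_path_def by auto
    then have end_K: "p ! 0 \<in> K" "p ! (length p - 1) \<in> K"
      using p(2,3) uv by (simp_all add: hd_conv_nth last_conv_nth)
    show "x \<in> K"
    proof (rule ccontr)
      assume "x \<notin> K"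
      then obtain j where j: "j < length p" "p ! j \<notin> K"
        using p(5) by (metis in_set_conv_nth)
      have j0: "j \<noteq> 0" "j \<noteq> length p - 1"
        using j end_K by metis+
      obtain i where i: "i < j" "p ! i \<in> K" "p ! Suc i \<notin> K"
      proof -
        have "\<exists>i<j. p ! i \<in> K \<and> p ! Suc i \<notin> K"
          using end_K(1) j(2) by (induction j) (auto simp: less_Suc_eq)
        then show ?thesis
          using that by blast
      qed
      obtain k where k: "j \<le> k" "Suc k < length p" "p ! k \<notin> K" "p ! Suc k \<in> K"
      proof -
        have "\<exists>k\<ge>j. Suc k \<le> j + d \<and> p ! k \<notin> K \<and> p ! Suc k \<in> K" if "p ! (j + d) \<in> K" for d
          using that j(2)
        proof (induction d)
          case (Suc d)
          then show ?case
            by (cases "p ! (j + d) \<in> K") (force intro: exI[of _ "j + d"])+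
        qed simp
        from this[of "length p - 1 - j"] show ?thesis
          using that j end_K(2) j0 by (auto intro: that)
      qed
      \<comment> \<open>The path leaves \<open>K\<close> after \<open>?s\<close> and enters it again
        at \<open>?t\<close>; these prove to be nonadjacent vertices of \<open>N\<close>, hence
        twins.\<close>
      let ?s = "p ! i" and ?t = "p ! Suc k"
      have st: "?s \<in> N" "?t \<in> N"
        using K_boundary[OF i(2) edge _ i(3)] K_boundary[OF k(4) sym[OF edge] _ k(3)] i k p_X by auto
      have ne: "?s \<noteq> ?t"
        using dist i k by (simp add: nth_eq_iff_index_eq)
      have n: "\<not> E ?s ?t"
        using non_edge i k by simp
      have tw: "E w ?s \<longleftrightarrow> E w ?t" if "w \<in> X" for w
        using N_twins[OF st ne n that] N_twins[OF st(2,1) ne[symmetric] _ that] n sym by blast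
      have "E (p ! Suc i) ?t"
        using tw[OF p_X[of "Suc i"]] sym[OF edge[of i]] i k by simp
      then have ki: "k = Suc i"
        using non_edge[of "Suc i" "Suc k"] i k by (cases "Suc i < k") auto
      \<comment> \<open>With at least three edges the path continues after \<open>?t\<close> or
        before \<open>?s\<close>; the vertex there is adjacent to both twins, which is a
        chord.\<close>
      show False
      proof (cases i)
        case 0
        then have "Suc (Suc k) < length p"
          using ki p(4) by simp
        then show False
          using tw[OF p_X] sym[OF edge[of "Suc k"]] sym non_edge[of i "Suc (Suc k)"] ki by simp
      next
        case (Suc h)
        then show False
          using tw[OF p_X[of h]] edge[of h] non_edge[of h "Suc k"] ki k(2) by simp
      qed
    qed
  qed
qed

text \<open>Nonadjacent vertices of \<open>W \<inter> N\<close> have a common neighbour in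
  \<open>W \<inter> K\<close>, found from a third vertex; this is where the bound 3 enters.\<close>

lemma connected_inter_K:
  assumes W: "connected_graph W E" "W \<subseteq> X" and c: "card (W \<inter> K) \<ge> 3"
  shows "connected_graph (W \<inter> K) E"
proof -
  let ?C = "W \<inter> K"
  have big: "\<exists>z\<in>?C. z \<noteq> s \<and> z \<noteq> t" for s t
  proof (rule ccontr)
    assume "\<not> ?thesis"
    then have "card ?C \<le> card {s, t}"
      by (intro card_mono) auto
    also have "\<dots> \<le> 2"
      by (simp add: card_insert_if)
    finally show False
      using c by simp
  qed
  have W_reach: "reach E W x y" if "x \<in> W" "y \<in> W" for x y
    using W(1) that unfolding connected_graph_def by blast
  have pendant: "\<exists>q\<in>W \<inter> N. E e q" if e: "e \<in> W" "e = a \<or> e = b" for e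
  proof -
    obtain z where "z \<in> W" "z \<noteq> e"
      using big[of e e] by auto
    then obtain q where "q \<in> W" "E e q"
      using reach_exit[OF W_reach[of e z], of "{e}"] e(1) by auto
    then show ?thesis
      using e(2) W(2) N_iff by blast
  qed
  have N_reach: "reach E ?C s t" if st: "s \<in> W" "s \<in> N" "t \<in> W" "t \<in> N" for s t
  proof (cases "s = t \<or> E s t")
    case True
    then show ?thesis
      using st by (auto intro: reach_refl reach_edge simp: K_def)
  next
    case False
    then have ne: "s \<noteq> t" and n: "\<not> E s t" "\<not> E t s"
      using sym by blast+
    obtain z where z: "z \<in> ?C" "E z s"
    proof (cases "\<exists>z\<in>W \<inter> N. z \<noteq> s \<and> z \<noteq> t")
      case True
      then obtain z where z: "z \<in> W" "z \<in> N" "z \<noteq> s" "z \<noteq> t"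
        by blast
      show ?thesis
        by (rule that[OF _ N_third[OF st(2,4) ne n(1) z(2-4)]]) (simp add: z K_def)
    next
      \<comment> \<open>Here \<open>W \<inter> N\<close> is \<open>{s, t}\<close>, so the third
        vertex is \<open>a\<close> or \<open>b\<close>. By connectedness it has a neighbour in
        \<open>{s, t}\<close>, hence by twins both.\<close>
      case none: False
      obtain z where z: "z \<in> ?C" "z \<noteq> s" "z \<noteq> t"
        using big[of s t] by auto
      then have "z = a \<or> z = b"
        using none unfolding K_def by blast
      then obtain q where "q \<in> W \<inter> N" "E z q"
        using pendant[of z] z(1) by auto
      then have "E z s \<or> E z t"
        using none by auto
      then have "E z s"
        using N_twins[OF st(4,2) ne[symmetric] n(2), of z] z(1) W(2) by auto
      then show ?thesis
        by (rule that[OF z(1)])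
    qed
    then have "E z t"
      using N_twins[OF st(2,4) ne n(1), of z] W(2) by auto
    then have "reach E ?C s z" "reach E ?C z t"
      using z st sym[OF z(2)] by (auto intro!: reach_edge simp: K_def)
    then show ?thesis
      by (rule reach_trans)
  qed
  have to_N: "\<exists>q\<in>W \<inter> N. reach E ?C u q" if u: "u \<in> ?C" for u
  proof (cases "u \<in> N")
    case True
    then show ?thesis
      using u by (intro bexI[of _ u] reach_refl) auto
  next
    case False
    then obtain q where "q \<in> W \<inter> N" "E u q"
      using pendant[of u] u by (auto simp: K_def)
    then show ?thesis
      using u by (intro bexI[of _ q] reach_edge) (auto simp: K_def)
  qed
  have "reach E ?C u v" if uv: "u \<in> ?C" "v \<in> ?C" for u v
  proof -
    obtain s where s: "s \<in> W \<inter> N" "reach E ?C u s"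
      using to_N[OF uv(1)] by blast
    obtain t where t: "t \<in> W \<inter> N" "reach E ?C v t"
      using to_N[OF uv(2)] by blast
    have "reach E ?C s t"
      using N_reach s(1) t(1) by simp
    then show ?thesis
      using reach_trans[OF reach_trans[OF s(2)] reach_sym[OF sym t(2)]] by blast
  qed
  moreover have "?C \<noteq> {}"
    using big[of a a] by auto
  ultimately show ?thesis
    unfolding connected_graph_def by blast
qed

text \<open>If \<open>W\<close> leaves \<open>K\<close>, growing the connected set
  \<open>W \<inter> K\<close> up to \<open>W\<close> yields a vertex outside \<open>K\<close>, hence
  outside \<open>U\<close>, that is not a cut vertex.\<close>

lemma K_m_3_convex: "m_3_convex V E K"
  unfolding m_3_convex_def
proof (intro allI impI)
  fix U
  assume U: "U \<subseteq> K \<and> card U = 3"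
  show "mono_interval_set V E U \<subseteq> K"
  proof (rule ccontr)
    assume "\<not> ?thesis"
    then obtain W F where tree: "minimal_tree V E U W F" and "\<not> W \<subseteq> K"
      unfolding mono_interval_set_def by blast
    have "m_3_convex V E X"
      using X_convex by (simp add: m33_convex_sets_def m33_convex_def)
    then have "mono_interval_set V E U \<subseteq> X"
      using U K_subset_X unfolding m_3_convex_def by (meson subset_trans)
    then have WX: "W \<subseteq> X"
      using tree unfolding mono_interval_set_def by blast
    then have fin: "finite W"
      using convex_subset[OF X_convex] finite_V by (meson finite_subset)
    have "connected_graph W F" "\<And>p q. F p q \<Longrightarrow> E p q"
      using tree unfolding minimal_tree_def is_tree_def subgraph_def by auto
    then have conn: "connected_graph W E"
      unfolding connected_graph_def using reach_mono[of F W _ _ E W] by blast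
    have "U \<subseteq> W \<inter> K"
      using tree U unfolding minimal_tree_def by blast
    then have "card (W \<inter> K) \<ge> 3"
      using U fin card_mono[of "W \<inter> K" U] by simp
    then have "connected_graph (W \<inter> K) E"
      using connected_inter_K conn WX by blast
    moreover have "W \<inter> K \<subset> W"
      using \<open>\<not> W \<subseteq> K\<close> by blast
    ultimately obtain x where "x \<in> W - W \<inter> K" "\<not> cut_vertex E W x"
      using non_cut_vertex_outside[OF sym conn fin] by blast
    moreover have "x \<in> W - U"
      using \<open>x \<in> W - W \<inter> K\<close> U by blast
    ultimately show False
      using tree unfolding minimal_tree_def by blast
  qed
qed

lemma contradiction: False
proof -
  have "K \<in> M"
    using K_m3_convex K_m_3_convex K_subset_X convex_subset[OF X_convex]
    unfolding m33_convex_sets_def m33_convex_def by blast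
  then have "X \<subseteq> K"
    by (intro hull_minimal) (auto simp: K_def)
  obtain u1 u2 u3 u4 where cfg: "A_config a b u1 u2 u3 u4"
    using config_exists by blast
  then have "u2 \<in> K"
    using A_config_hull(1) \<open>X \<subseteq> K\<close> by blast
  then show False
    using cfg sym unfolding K_def N_def A_config_def by blast
qed

end

section \<open>Passing to a configuration of smallest hull\<close>

lemma (in m33_geometry) no_A_config: "\<not> A_config a b u1 u2 u3 u4"
proof
  assume cfg: "A_config a b u1 u2 u3 u4"
  let ?P = "\<lambda>(a, b). \<exists>u1 u2 u3 u4. A_config a b u1 u2 u3 u4"
  obtain c where c: "?P c" "\<And>c'. ?P c' \<Longrightarrow> card (hull {fst c, snd c}) \<le> card (hull {fst c', snd c'})"
    using ex_has_least_nat[of ?P "(a, b)" "\<lambda>c. card (hull {fst c, snd c})"] cfg by blast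
  have "m33_geometry_minimal_A V E (fst c) (snd c)"
  proof unfold_locales
    show "\<exists>u1 u2 u3 u4. A_config (fst c) (snd c) u1 u2 u3 u4"
      using c(1) by (auto split: prod.splits)
    show "card (hull {fst c, snd c}) \<le> card (hull {a', b'})" if "A_config a' b' v1 v2 v3 v4"
      for a' b' v1 v2 v3 v4
      using c(2)[of "(a', b')"] that by auto
  qed
  then show False
    by (rule m33_geometry_minimal_A.contradiction)
qed

theorem theorem3:
  fixes V :: "'a set" and E :: "'a \<Rightarrow> 'a \<Rightarrow> bool"
  assumes "graph V E"
    and "connected_graph V E"
    and "convex_geometry V (m33_convex_sets V E)"
  shows "A_free V E"
  unfolding A_free_def
proof
  interpret m33_geometry V E
    by unfold_locales (fact assms)+
  assume "has_induced V E A_vertices A_edge"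
  then obtain f where f: "\<forall>x\<in>A_vertices. \<forall>y\<in>A_vertices. E (f x) (f y) \<longleftrightarrow> A_edge x y"
    unfolding has_induced_def by auto
  \<comment> \<open>In the coding of the A-graph, 0 and 1 are the pendant vertices and 2 to 5 run
    around the cycle.\<close>
  have "A_config (f 0) (f 1) (f 2) (f 3) (f 4) (f 5)"
    unfolding A_config_def by (simp add: f A_vertices_def A_edge_def doubleton_eq_iff)
  then show False
    using no_A_config by blast
qed

end
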